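(* Let $\mu,\nu\in\mathcal{P}_2(\mathbb{R}^d)$. (i) Let $k$ be a Markov kernel on $\mathbb{R}^d$ such that $\mu(dx)k(x,dy)\in\Pi^{opt}(\mu,\nu)$, let $\mathcal{T}(x)=\int_{\mathbb{R}^d}y\,k(x,dy)$ and $\eta=\mathcal{T}\#\mu$. Then $\eta\le_{\mathrm{cx}}\nu$, $$W_2^2(\mu,\nu)=W_2^2(\mu,\eta)+\int_{\mathbb{R}^d}|y|^2\nu(dy)-\int_{\mathbb{R}^d}|z|^2\eta(dz),\qquad(\ast)$$ and $(I_d,\mathcal{T})\#\mu\in\Pi^{opt}(\mu,\eta)$. (ii) Conversely, let $\eta$ be a probability measure on $\mathbb{R}^d$ with $\eta\le_{\mathrm{cx}}\nu$ such that $(\ast)$ holds. Then for every coupling $\mu(dx)q(x,dz)\in\Pi^{opt}(\mu,\eta)$ and every martingale coupling $\eta(dz)m(z,dy)$ between $\eta$ and $\nu$, the measure $\mu(dx)\,qm(x,dy)$, where $qm(x,dy)=\int_{z\in\mathbb{R}^d}q(x,dz)m(z,dy)$, belongs to $\Pi^{opt}(\mu,\nu)$.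
   Context: $\mathcal{P}_2(\mathbb{R}^d)$ is the set of Borel probability measures on $\mathbb{R}^d$ with finite second order moment, $|\cdot|$ is the Euclidean norm, $\Pi(\mu,\nu)$ is the set of probability measures on $\mathbb{R}^d\times\mathbb{R}^d$ with first marginal $\mu$ and second marginal $\nu$, $W_2^2(\mu,\nu)=\inf_{\pi\in\Pi(\mu,\nu)}\int|y-x|^2\pi(dx,dy)$, and $\Pi^{opt}(\mu,\nu)$ is the (non-empty) set of $\pi\in\Pi(\mu,\nu)$ attaining this infimum. $I_d$ is the identity map of $\mathbb{R}^d$ and $T\#\mu$ is the image (push-forward) of $\mu$ by $T$. Any coupling $\pi\in\Pi(\mu,\nu)$ disintegrates as $\pi(dx,dy)=\mu(dx)k(x,dy)$ with $k$ a Markov kernel on $\mathbb{R}^d$, unique $\mu(dx)$-a.e.; $\mathcal T$ is then defined $\mu$-a.e. Convex order: for probability measures $\eta,\nu$ on $\mathbb{R}^d$, $\eta\le_{\mathrm{cx}}\nu$ means $\int\phi\,d\eta\le\int\phi\,d\nu$ for every convex $\phi:\mathbb{R}^d\to\mathbb{R}$ such that the integrals make sense. A martingale kernel is a Markov kernel $m$ such that for all $z\in\mathbb{R}^d$, $\int|y|m(z,dy)<\infty$ and $\int y\,m(z,dy)=z$; a martingale coupling between $\eta$ and $\nu$ is an element of $\Pi(\eta,\nu)$ of the form $\eta(dz)m(z,dy)$ with $m$ a martingale kernel. *)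

theory Defs
  imports "HOL-Probability.Probability"
begin

definition P2 :: "'a::euclidean_space measure set" where
  "P2 = {\<mu>. prob_space \<mu> \<and> sets \<mu> = sets borel \<and> (\<integral>\<^sup>+x. ennreal ((norm x)\<^sup>2) \<partial>\<mu>) < \<infinity>}"

definition couplings ::
    "'a::euclidean_space measure \<Rightarrow> 'a measure \<Rightarrow> ('a \<times> 'a) measure set" where
  "couplings \<mu> \<nu> = {\<pi>. prob_space \<pi> \<and> sets \<pi> = sets (borel \<Otimes>\<^sub>M borel) \<and>
     distr \<pi> borel fst = \<mu> \<and> distr \<pi> borel snd = \<nu>}"

definition transport_cost :: "('a::euclidean_space \<times> 'a) measure \<Rightarrow> ennreal" where
  "transport_cost \<pi> = (\<integral>\<^sup>+(x, y). ennreal ((norm (y - x))\<^sup>2) \<partial>\<pi>)"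

definition W2_sq :: "'a::euclidean_space measure \<Rightarrow> 'a measure \<Rightarrow> ennreal" where
  "W2_sq \<mu> \<nu> = (INF \<pi>\<in>couplings \<mu> \<nu>. transport_cost \<pi>)"

definition opt_couplings ::
    "'a::euclidean_space measure \<Rightarrow> 'a measure \<Rightarrow> ('a \<times> 'a) measure set" where
  "opt_couplings \<mu> \<nu> = {\<pi> \<in> couplings \<mu> \<nu>. transport_cost \<pi> = W2_sq \<mu> \<nu>}"

definition markov_kernel :: "('a::euclidean_space \<Rightarrow> 'a measure) \<Rightarrow> bool" where
  "markov_kernel k \<longleftrightarrow> k \<in> borel \<rightarrow>\<^sub>M prob_algebra borel"

(* The measure \<mu>(dx) k(x,dy): draw x from \<mu>, then y from k x. *)
definition kernel_coupling ::
    "'a::euclidean_space measure \<Rightarrow> ('a \<Rightarrow> 'a measure) \<Rightarrow> ('a \<times> 'a) measure" where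
  "kernel_coupling \<mu> k = do {x \<leftarrow> \<mu>; y \<leftarrow> k x; return (borel \<Otimes>\<^sub>M borel) (x, y)}"

(* The kernel qm(x,dy) = \<integral> q(x,dz) m(z,dy). *)
definition kernel_comp ::
    "('a::euclidean_space \<Rightarrow> 'a measure) \<Rightarrow> ('a \<Rightarrow> 'a measure) \<Rightarrow> 'a \<Rightarrow> 'a measure" where
  "kernel_comp q m = (\<lambda>x. q x \<bind> m)"

(* Where y is not integrable under k x, the Bochner integral takes the value 0; when
   \<mu>(dx) k(x,dy) has a second marginal in P2 this happens only on a \<mu>-null set. *)
definition barycenter_map :: "('a::euclidean_space \<Rightarrow> 'a measure) \<Rightarrow> 'a \<Rightarrow> 'a" where
  "barycenter_map k = (\<lambda>x. \<integral>y. y \<partial>(k x))"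

definition martingale_kernel :: "('a::euclidean_space \<Rightarrow> 'a measure) \<Rightarrow> bool" where
  "martingale_kernel m \<longleftrightarrow> markov_kernel m \<and>
     (\<forall>z. integrable (m z) (\<lambda>y. y) \<and> (\<integral>y. y \<partial>(m z)) = z)"

(* The integral of f makes sense, as an element of [-\<infinity>, \<infinity>], when f\<^sup>+ and f\<^sup>- do not
   both have infinite integral (ennreal truncates negative reals to 0).  Requiring integrability
   instead would make the convex order below vacuous for heavy-tailed measures. *)
definition integral_makes_sense :: "'a measure \<Rightarrow> ('a \<Rightarrow> real) \<Rightarrow> bool" where
  "integral_makes_sense M f \<longleftrightarrow> f \<in> borel_measurable M \<and>
     ((\<integral>\<^sup>+x. ennreal (f x) \<partial>M) < \<infinity> \<or> (\<integral>\<^sup>+x. ennreal (- f x) \<partial>M) < \<infinity>)"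

definition ext_integral :: "'a measure \<Rightarrow> ('a \<Rightarrow> real) \<Rightarrow> ereal" where
  "ext_integral M f =
     enn2ereal (\<integral>\<^sup>+x. ennreal (f x) \<partial>M) - enn2ereal (\<integral>\<^sup>+x. ennreal (- f x) \<partial>M)"

definition convex_order :: "'a::euclidean_space measure \<Rightarrow> 'a measure \<Rightarrow> bool"
    (infix "\<le>\<^sub>c\<^sub>x" 50) where
  "\<eta> \<le>\<^sub>c\<^sub>x \<nu> \<longleftrightarrow> (\<forall>\<phi>::'a \<Rightarrow> real. convex_on UNIV \<phi> \<longrightarrow>
     integral_makes_sense \<eta> \<phi> \<longrightarrow> integral_makes_sense \<nu> \<phi> \<longrightarrow>
     ext_integral \<eta> \<phi> \<le> ext_integral \<nu> \<phi>)"

(* The identity W\<^sub>2\<^sup>2(\<mu>,\<nu>) = W\<^sub>2\<^sup>2(\<mu>,\<eta>) + \<integral>|y|\<^sup>2 \<nu>(dy) - \<integral>|z|\<^sup>2 \<eta>(dz), read in ereal.  As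
   \<infinity> - \<infinity> = \<infinity> there, for \<mu>, \<nu> in P2 it forces \<eta> to have a finite second moment. *)
definition W2_split ::
    "'a::euclidean_space measure \<Rightarrow> 'a measure \<Rightarrow> 'a measure \<Rightarrow> bool" where
  "W2_split \<mu> \<nu> \<eta> \<longleftrightarrow>
     enn2ereal (W2_sq \<mu> \<nu>) =
       enn2ereal (W2_sq \<mu> \<eta>) + enn2ereal (\<integral>\<^sup>+y. ennreal ((norm y)\<^sup>2) \<partial>\<nu>)
         - enn2ereal (\<integral>\<^sup>+z. ennreal ((norm z)\<^sup>2) \<partial>\<eta>)"

end

theory Submission
  imports Defs
begin

text \<open>
  Write \<open>V x\<close> for the variance of \<open>k x\<close> around its barycenter \<open>T x\<close>. For every \<open>a\<close> the
  bias-variance identity gives \<open>\<integral>|y - a|\<^sup>2 k(x,dy) = V x + |T x - a|\<^sup>2\<close>. Hence drawing \<open>y\<close>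
  from \<open>k w\<close> for a pair \<open>(x, w)\<close> costs \<open>\<integral>V\<close> plus the cost of \<open>(x, T w)\<close>, while the
  second moments of \<open>\<nu>\<close> and \<open>\<eta>\<close> differ exactly by \<open>\<integral>V\<close>. For (ii), apply this to the kernel
  \<open>m\<close> with \<open>(x, w)\<close> distributed according to the optimal coupling of \<open>\<mu>\<close> and \<open>\<eta>\<close>.

  For (i) it remains to show \<open>W\<^sub>2\<^sup>2(\<mu>,\<nu>) \<le> \<integral>V + W\<^sub>2\<^sup>2(\<mu>,\<eta>)\<close>. Composing a coupling of \<open>\<mu>\<close> and
  \<open>\<eta>\<close> with a martingale kernel from \<open>\<eta>\<close> to \<open>\<nu>\<close> would need a disintegration. Instead, cut the
  space into countably many cells of diameter below \<open>e\<close> and glue a coupling \<open>(x', z)\<close> of \<open>\<mu>\<close>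
  and \<open>\<eta>\<close> with \<open>x\<close> of law \<open>\<mu>\<close> so that \<open>z\<close> and \<open>T x\<close> lie in the same cell; this gluing has
  an explicit density with respect to the product measure. Drawing \<open>y\<close> from \<open>k x\<close> couples \<open>\<mu>\<close>
  and \<open>\<nu>\<close> at a cost that exceeds the desired one by an error vanishing with \<open>e\<close>.

  The convex order follows from Jensen's inequality after subtracting an affine minorant, since
  \<open>\<eta>\<close> and \<open>\<nu>\<close> have the same mean.
\<close>

subsection \<open>Appending a kernel to a coupling\<close>

text \<open>Expanding the square around the mean \<open>b\<close>, the cross term
  \<open>2 * inner (y - b) (b - a)\<close> has integral zero. The identity lives in
  \<open>ennreal\<close>, so it also covers an infinite variance.\<close>

lemma nn_integral_norm_diff_sq:
  fixes a :: "'a::euclidean_space"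
  assumes "prob_space M" and [measurable_cong]: "sets M = sets borel" and int: "integrable M (\<lambda>y. y)"
  defines "b \<equiv> \<integral>y. y \<partial>M"
  shows "(\<integral>\<^sup>+y. ennreal ((norm (y - a))\<^sup>2) \<partial>M) =
           (\<integral>\<^sup>+y. ennreal ((norm (y - b))\<^sup>2) \<partial>M) + ennreal ((norm (b - a))\<^sup>2)"
proof -
  interpret prob_space M by fact
  have expand_fun: "(\<lambda>y. (norm (y - a))\<^sup>2) =
      (\<lambda>y. (norm (y - b))\<^sup>2 + 2 * inner (y - b) (b - a) + (norm (b - a))\<^sup>2)"
    by (simp add: fun_eq_iff power2_norm_eq_inner inner_diff inner_commute algebra_simps)
  show ?thesis
  proof (cases "integrable M (\<lambda>y. (norm (y - b))\<^sup>2)")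
    case True
    have cross: "integrable M (\<lambda>y. 2 * inner (y - b) (b - a))"
      using int by (intro integrable_mult_right integrable_inner_left Bochner_Integration.integrable_diff) auto
    have "(\<integral>y. inner (y - b) (b - a) \<partial>M) = inner (\<integral>y. y - b \<partial>M) (b - a)"
      using int by (intro integral_inner_left) auto
    also have "(\<integral>y. y - b \<partial>M) = 0"
      using int by (simp add: b_def prob_space)
    finally have zero: "(\<integral>y. 2 * inner (y - b) (b - a) \<partial>M) = 0" by simp
    have a: "integrable M (\<lambda>y. (norm (y - a))\<^sup>2)"
      unfolding expand_fun using True cross by auto
    have "(\<integral>y. (norm (y - a))\<^sup>2 \<partial>M) = (\<integral>y. (norm (y - b))\<^sup>2 \<partial>M) + (norm (b - a))\<^sup>2"
      unfolding expand_fun using True cross zero by (simp add: prob_space)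
    then show ?thesis
      unfolding nn_integral_eq_integral[OF True, simplified] nn_integral_eq_integral[OF a, simplified]
      by (simp add: ennreal_plus)
  next
    case False
    then have inf: "(\<integral>\<^sup>+y. ennreal ((norm (y - b))\<^sup>2) \<partial>M) = \<infinity>"
      by (subst (asm) integrable_iff_bounded) (simp add: less_top[symmetric])
    \<comment> \<open>With infinite variance around \<open>b\<close>, this bound forces the second
      moment around \<open>a\<close> to be infinite as well, so both sides equal infinity.\<close>
    have le: "(norm (y - b))\<^sup>2 \<le> 2 * (norm (y - a))\<^sup>2 + 2 * (norm (b - a))\<^sup>2" for y
    proof -
      have "(norm (y - b))\<^sup>2 \<le> (norm (y - a) + norm (b - a))\<^sup>2"
        using norm_triangle_ineq4[of "y - a" "b - a"] by (intro power_mono) simp_all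
      also have "\<dots> \<le> 2 * (norm (y - a))\<^sup>2 + 2 * (norm (b - a))\<^sup>2"
        using sum_squares_bound[of "norm (y - a)" "norm (b - a)"] by (simp add: power2_sum)
      finally show ?thesis .
    qed
    have "(\<integral>\<^sup>+y. ennreal ((norm (y - b))\<^sup>2) \<partial>M) \<le>
        (\<integral>\<^sup>+y. ennreal 2 * ennreal ((norm (y - a))\<^sup>2) + ennreal (2 * (norm (b - a))\<^sup>2) \<partial>M)"
    proof (rule nn_integral_mono)
      fix y
      show "ennreal ((norm (y - b))\<^sup>2) \<le>
          ennreal 2 * ennreal ((norm (y - a))\<^sup>2) + ennreal (2 * (norm (b - a))\<^sup>2)"
        unfolding ennreal_mult'[of 2, symmetric, OF zero_le_numeral]
        by (simp add: ennreal_plus[symmetric] le del: ennreal_plus)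
    qed
    also have "\<dots> = ennreal 2 * (\<integral>\<^sup>+y. ennreal ((norm (y - a))\<^sup>2) \<partial>M) + ennreal (2 * (norm (b - a))\<^sup>2)"
      by (simp add: nn_integral_add nn_integral_cmult emeasure_space_1 del: ennreal_numeral)
    finally have "(\<integral>\<^sup>+y. ennreal ((norm (y - a))\<^sup>2) \<partial>M) = \<infinity>"
      unfolding inf by (auto simp: top_unique ennreal_add_eq_top ennreal_mult_eq_top_iff)
    with inf show ?thesis by simp
  qed
qed

text \<open>The law of \<open>(x, y)\<close> when \<open>(x, w)\<close> has law \<open>S\<close> and
  \<open>y\<close> is drawn from \<open>k w\<close>; the middle point \<open>w\<close> is then
  forgotten. With \<open>S\<close> on the diagonal it is \<mu>(dx) k(x,dy), with \<open>S\<close> a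
  kernel coupling it is a composition of kernels, and with \<open>S\<close> a gluing it supplies the
  competitors in the upper bound for \<open>W2_sq\<close>.\<close>

definition append_kernel ::
    "('a \<times> 'a) measure \<Rightarrow> ('a \<Rightarrow> 'a measure) \<Rightarrow> ('a::euclidean_space \<times> 'a) measure" where
  "append_kernel S k = S \<bind> (\<lambda>(x, w). distr (k w) (borel \<Otimes>\<^sub>M borel) (Pair x))"

definition kernel_variance :: "('a::euclidean_space \<Rightarrow> 'a measure) \<Rightarrow> 'a \<Rightarrow> ennreal" where
  "kernel_variance k x = (\<integral>\<^sup>+y. ennreal ((norm (y - barycenter_map k x))\<^sup>2) \<partial>k x)"

lemma markov_kernel_measurable:
  assumes "markov_kernel k"
  shows "k \<in> borel \<rightarrow>\<^sub>M prob_algebra borel" "k \<in> borel \<rightarrow>\<^sub>M subprob_algebra borel"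
  using assms by (auto simp: markov_kernel_def intro: measurable_prob_algebraD)

lemma markov_kernelD:
  assumes "markov_kernel k"
  shows "prob_space (k x)" "sets (k x) = sets borel"
  using measurable_space[OF markov_kernel_measurable(1)[OF assms], of x]
  by (auto simp: space_prob_algebra)

lemma barycenter_map_measurable:
  assumes "markov_kernel k"
  shows "barycenter_map k \<in> borel_measurable borel"
  unfolding barycenter_map_def
  by (rule measurable_compose[OF markov_kernel_measurable(2)[OF assms]]) measurable

lemma kernel_variance_measurable:
  assumes "markov_kernel k"
  shows "kernel_variance k \<in> borel_measurable borel"
proof -
  note [measurable] = barycenter_map_measurable[OF assms]
  show ?thesis
    unfolding kernel_variance_def
    by (rule nn_integral_measurable_subprob_algebra2[OF _ markov_kernel_measurable(2)[OF assms]]) measurable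
qed

lemma kernel_norm_diff_sq:
  assumes "markov_kernel k" and "integrable (k x) (\<lambda>y. y)"
  shows "(\<integral>\<^sup>+y. ennreal ((norm (y - a))\<^sup>2) \<partial>k x) =
           kernel_variance k x + ennreal ((norm (barycenter_map k x - a))\<^sup>2)"
  unfolding kernel_variance_def barycenter_map_def
  by (rule nn_integral_norm_diff_sq[OF markov_kernelD[OF assms(1)] assms(2)])

lemma append_kernel_measurable:
  assumes "markov_kernel k"
  shows "(\<lambda>(x, w). distr (k w) (borel \<Otimes>\<^sub>M borel) (Pair x))
           \<in> borel \<Otimes>\<^sub>M borel \<rightarrow>\<^sub>M prob_algebra (borel \<Otimes>\<^sub>M borel)"
  unfolding case_prod_beta
  by (rule measurable_distr_prob_space2[OF measurable_compose[OF measurable_snd markov_kernel_measurable(1)[OF assms]]])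
     measurable

lemma append_kernel_couplings:
  assumes k: "markov_kernel k" and S: "prob_space S" "sets S = sets (borel \<Otimes>\<^sub>M borel)"
  shows "append_kernel S k \<in> couplings (distr S borel fst) (distr S borel snd \<bind> k)"
proof -
  have S': "S \<in> space (prob_algebra (borel \<Otimes>\<^sub>M borel))"
    using S by (simp add: space_prob_algebra)
  note K = append_kernel_measurable[OF k]
  have K': "(\<lambda>(x, w). distr (k w) (borel \<Otimes>\<^sub>M borel) (Pair x))
      \<in> S \<rightarrow>\<^sub>M subprob_algebra (borel \<Otimes>\<^sub>M borel)"
    using measurable_prob_algebraD[OF K] S(2) by (simp cong: measurable_cong_sets)
  have ne: "space S \<noteq> {}" using S(1) by (rule prob_space.not_empty)
  have [measurable_cong]: "sets (k w) = sets borel" for w using markov_kernelD[OF k] by simp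
  interpret k: prob_space "k w" for w using markov_kernelD[OF k] by simp
  have "distr (append_kernel S k) borel fst = S \<bind> (\<lambda>z. return borel (fst z))"
    unfolding append_kernel_def
    by (subst distr_bind[OF K' ne]) (auto simp: case_prod_beta distr_distr comp_def k.distr_const)
  also have "\<dots> = distr S borel fst"
    using ne S(2) by (intro bind_return_distr') (auto cong: measurable_cong_sets)
  finally have 1: "distr (append_kernel S k) borel fst = distr S borel fst" .
  have "distr (append_kernel S k) borel snd = S \<bind> (\<lambda>z. k (snd z))"
    unfolding append_kernel_def
    by (subst distr_bind[OF K' ne])
       (auto simp: case_prod_beta distr_distr comp_def fun_eq_iff markov_kernelD[OF k]
             intro!: arg_cong2[where f=bind] distr_id2)
  also have "\<dots> = distr S borel snd \<bind> k"
    using ne S(2) by (subst bind_distr[where K=borel]) (auto simp: markov_kernel_measurable[OF k] cong: measurable_cong_sets)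
  finally have 2: "distr (append_kernel S k) borel snd = distr S borel snd \<bind> k" .
  show ?thesis
    using prob_space_bind'[OF S' K] sets_bind'[OF S' K] 1 2
    by (simp add: couplings_def append_kernel_def)
qed

text \<open>The bias-variance identity is applied to \<open>k w\<close> with \<open>a = x\<close>,
  for almost every pair \<open>(x, w)\<close>. The variance term does not involve \<open>x\<close>,
  so it depends on \<open>S\<close> only through the second marginal.\<close>

lemma transport_cost_append_kernel:
  assumes k: "markov_kernel k" and S: "prob_space S" "sets S = sets (borel \<Otimes>\<^sub>M borel)"
    and int: "AE w in distr S borel snd. integrable (k w) (\<lambda>y. y)"
  shows "transport_cost (append_kernel S k) =
     (\<integral>\<^sup>+w. kernel_variance k w \<partial>distr S borel snd) +
     transport_cost (distr S (borel \<Otimes>\<^sub>M borel) (\<lambda>(x, w). (x, barycenter_map k w)))"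
proof -
  note [measurable_cong] = S(2)
  note [measurable] = barycenter_map_measurable[OF k] kernel_variance_measurable[OF k]
  have [measurable_cong]: "sets (k w) = sets borel" for w using markov_kernelD[OF k] by simp
  have K: "(\<lambda>(x, w). distr (k w) (borel \<Otimes>\<^sub>M borel) (Pair x))
      \<in> S \<rightarrow>\<^sub>M subprob_algebra (borel \<Otimes>\<^sub>M borel)"
    using measurable_prob_algebraD[OF append_kernel_measurable[OF k]]
    by (simp add: measurable_cong_sets[OF S(2) refl])
  have int': "AE z in S. integrable (k (snd z)) (\<lambda>y. y)"
    by (rule AE_distrD[OF _ int]) measurable
  have "transport_cost (append_kernel S k) =
      (\<integral>\<^sup>+z. (\<integral>\<^sup>+y. ennreal ((norm (y - fst z))\<^sup>2) \<partial>k (snd z)) \<partial>S)"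
    unfolding transport_cost_def append_kernel_def
    by (subst nn_integral_bind[OF _ K]) (auto simp: case_prod_beta nn_integral_distr)
  also have "\<dots> = (\<integral>\<^sup>+z. kernel_variance k (snd z) + ennreal ((norm (barycenter_map k (snd z) - fst z))\<^sup>2) \<partial>S)"
    using int'
    by (intro nn_integral_cong_AE)
       (auto simp: kernel_norm_diff_sq[OF k])
  also have "\<dots> = (\<integral>\<^sup>+z. kernel_variance k (snd z) \<partial>S) + (\<integral>\<^sup>+z. ennreal ((norm (barycenter_map k (snd z) - fst z))\<^sup>2) \<partial>S)"
    by (rule nn_integral_add) measurable
  finally show ?thesis
    by (simp add: transport_cost_def nn_integral_distr case_prod_beta)
qed

text \<open>The same identity with a fixed centre \<open>a\<close>. The choice \<open>a = 0\<close>
  compares second moments; other centres serve to compare means.\<close>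

lemma nn_integral_norm_diff_sq_bind:
  assumes k: "markov_kernel k" and S: "sets \<mu> = sets borel"
    and int: "AE x in \<mu>. integrable (k x) (\<lambda>y. y)"
  shows "(\<integral>\<^sup>+y. ennreal ((norm (y - a))\<^sup>2) \<partial>(\<mu> \<bind> k)) =
     (\<integral>\<^sup>+x. kernel_variance k x \<partial>\<mu>) +
     (\<integral>\<^sup>+z. ennreal ((norm (z - a))\<^sup>2) \<partial>distr \<mu> borel (barycenter_map k))"
proof -
  note [measurable_cong] = S
  note [measurable] = barycenter_map_measurable[OF k] kernel_variance_measurable[OF k]
  have K: "k \<in> \<mu> \<rightarrow>\<^sub>M subprob_algebra borel"
    using markov_kernel_measurable[OF k] by (simp cong: measurable_cong_sets)
  have "(\<integral>\<^sup>+y. ennreal ((norm (y - a))\<^sup>2) \<partial>(\<mu> \<bind> k)) =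
      (\<integral>\<^sup>+x. (\<integral>\<^sup>+y. ennreal ((norm (y - a))\<^sup>2) \<partial>k x) \<partial>\<mu>)"
    by (subst nn_integral_bind[OF _ K]) auto
  also have "\<dots> = (\<integral>\<^sup>+x. kernel_variance k x + ennreal ((norm (barycenter_map k x - a))\<^sup>2) \<partial>\<mu>)"
    using int
    by (intro nn_integral_cong_AE)
       (auto simp: kernel_norm_diff_sq[OF k])
  also have "\<dots> = (\<integral>\<^sup>+x. kernel_variance k x \<partial>\<mu>) + (\<integral>\<^sup>+x. ennreal ((norm (barycenter_map k x - a))\<^sup>2) \<partial>\<mu>)"
    by (rule nn_integral_add) measurable
  finally show ?thesis
    by (simp add: nn_integral_distr)
qed

section \<open>Integrability under a finite second moment\<close>

lemma P2_integrable:
  assumes "\<nu> \<in> P2" shows "integrable \<nu> (\<lambda>y. y)"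
proof -
  interpret prob_space \<nu> using assms by (simp add: P2_def)
  have [measurable_cong]: "sets \<nu> = sets borel" using assms by (simp add: P2_def)
  have "integrable \<nu> (\<lambda>y. (norm y)\<^sup>2)"
    using assms by (intro integrableI_bounded) (auto simp: P2_def)
  then have "integrable \<nu> (\<lambda>y. norm y)"
    by (rule square_integrable_imp_integrable[rotated]) auto
  then show ?thesis by (subst (asm) integrable_norm_iff) auto
qed

text \<open>The second moment of \<open>\<mu> \<bind> k\<close> is the \<mu>-average of those of
  \<open>k x\<close>, hence almost every \<open>k x\<close> lies in \<open>P2\<close>.\<close>

lemma AE_kernel_integrable:
  assumes k: "markov_kernel k" and S: "sets \<mu> = sets borel" and "\<mu> \<bind> k \<in> P2"
  shows "AE x in \<mu>. integrable (k x) (\<lambda>y. y)"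
proof -
  note [measurable_cong] = S
  have K: "k \<in> \<mu> \<rightarrow>\<^sub>M subprob_algebra borel"
    using markov_kernel_measurable[OF k] by (simp cong: measurable_cong_sets)
  have "(\<integral>\<^sup>+x. (\<integral>\<^sup>+y. ennreal ((norm y)\<^sup>2) \<partial>k x) \<partial>\<mu>) \<noteq> \<infinity>"
    using assms(3) by (subst nn_integral_bind[OF _ K, symmetric]) (auto simp: P2_def)
  then have "AE x in \<mu>. (\<integral>\<^sup>+y. ennreal ((norm y)\<^sup>2) \<partial>k x) \<noteq> \<infinity>"
    by (rule nn_integral_PInf_AE[rotated])
       (rule measurable_compose[OF K], measurable)
  then show ?thesis
    by eventually_elim
       (auto intro!: P2_integrable simp: P2_def markov_kernelD[OF k] top.not_eq_extremum)
qed

section \<open>Kernel couplings and compositions as appended kernels\<close>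

lemma kernel_coupling_eq_append_kernel:
  assumes k: "markov_kernel k" and "prob_space \<mu>" "sets \<mu> = sets borel"
  shows "kernel_coupling \<mu> k = append_kernel (distr \<mu> (borel \<Otimes>\<^sub>M borel) (\<lambda>x. (x, x))) k"
proof -
  note [measurable_cong] = assms(3)
  have [measurable_cong]: "sets (k w) = sets borel" for w using markov_kernelD[OF k] by simp
  have ne: "space (k x) \<noteq> {}" "space \<mu> \<noteq> {}" for x
    using markov_kernelD(1)[OF k] assms(2) by (auto dest: prob_space.not_empty)
  have "append_kernel (distr \<mu> (borel \<Otimes>\<^sub>M borel) (\<lambda>x. (x, x))) k =
     \<mu> \<bind> (\<lambda>x. distr (k x) (borel \<Otimes>\<^sub>M borel) (Pair x))"
    unfolding append_kernel_def
    using ne measurable_prob_algebraD[OF append_kernel_measurable[OF k]]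
    by (subst bind_distr) auto
  also have "\<dots> = kernel_coupling \<mu> k"
    unfolding kernel_coupling_def using ne by (subst bind_return_distr') auto
  finally show ?thesis ..
qed

text \<open>Associativity of \<open>bind\<close>: drawing \<open>y\<close> from the mixture
  \<open>q x \<bind> m\<close> amounts to drawing \<open>z\<close> from \<open>q x\<close>, then
  \<open>y\<close> from \<open>m z\<close>, and forgetting \<open>z\<close>.\<close>

lemma kernel_coupling_kernel_comp:
  assumes q: "markov_kernel q" and m: "markov_kernel m" and "prob_space \<mu>" "sets \<mu> = sets borel"
  shows "kernel_coupling \<mu> (kernel_comp q m) = append_kernel (kernel_coupling \<mu> q) m"
proof -
  note [measurable_cong] = assms(4)
  note [measurable] = markov_kernel_measurable[OF q] markov_kernel_measurable[OF m]
  have [measurable_cong]: "sets (q w) = sets borel" "sets (m w) = sets borel" for w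
    using markov_kernelD[OF q] markov_kernelD[OF m] by simp_all
  have ne: "space (m x) \<noteq> {}" for x
    using markov_kernelD(1)[OF m] by (rule prob_space.not_empty)
  note F = measurable_prob_algebraD[OF append_kernel_measurable[OF m]]
  have R: "(\<lambda>z. return (borel \<Otimes>\<^sub>M borel) (x, z)) \<in> borel \<rightarrow>\<^sub>M subprob_algebra (borel \<Otimes>\<^sub>M borel)" for x :: 'a
    by measurable
  have R2: "(\<lambda>p. return (borel \<Otimes>\<^sub>M borel) (fst p, snd p)) \<in> \<mu> \<Otimes>\<^sub>M borel \<rightarrow>\<^sub>M subprob_algebra (borel \<Otimes>\<^sub>M borel)"
    by measurable
  have "append_kernel (kernel_coupling \<mu> q) m =
      \<mu> \<bind> (\<lambda>x. (q x \<bind> (\<lambda>z. return (borel \<Otimes>\<^sub>M borel) (x, z))) \<bind>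
        (\<lambda>(x, w). distr (m w) (borel \<Otimes>\<^sub>M borel) (Pair x)))"
    unfolding append_kernel_def kernel_coupling_def
    by (rule bind_assoc[OF _ F], rule measurable_bind[OF _ R2]) measurable
  also have "\<dots> = \<mu> \<bind> (\<lambda>x. q x \<bind> (\<lambda>z. distr (m z) (borel \<Otimes>\<^sub>M borel) (Pair x)))"
    using R by (subst bind_assoc[OF _ F]) (auto simp: bind_return[OF F] space_pair_measure cong: measurable_cong_sets)
  also have "\<dots> = \<mu> \<bind> (\<lambda>x. q x \<bind> (\<lambda>z. m z \<bind> (\<lambda>y. return (borel \<Otimes>\<^sub>M borel) (x, y))))"
    using ne by (subst bind_return_distr') auto
  also have "\<dots> = \<mu> \<bind> (\<lambda>x. (q x \<bind> m) \<bind> (\<lambda>y. return (borel \<Otimes>\<^sub>M borel) (x, y)))"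
    by (subst bind_assoc[OF _ R]) measurable
  finally show ?thesis
    by (simp add: kernel_coupling_def kernel_comp_def)
qed

subsection \<open>Gluing along a countable partition\<close>

text \<open>The union of the null fibres is null, since there are only countably many
  labels.\<close>

lemma AE_fibre_nonnull:
  fixes b :: "'b \<Rightarrow> 'i::countable"
  assumes [measurable]: "b \<in> K \<rightarrow>\<^sub>M count_space UNIV"
  shows "AE y in K. emeasure K (b -` {b y} \<inter> space K) \<noteq> 0"
proof -
  have "AE y in K. b y = i \<longrightarrow> emeasure K (b -` {i} \<inter> space K) \<noteq> 0" for i
  proof (cases "emeasure K (b -` {i} \<inter> space K) = 0")
    case True
    then have "b -` {i} \<inter> space K \<in> null_sets K" by (auto intro!: null_setsI)
    then have "AE y in K. y \<notin> b -` {i} \<inter> space K" by (rule AE_not_in)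
    then show ?thesis using AE_space by eventually_elim auto
  qed simp
  then have "AE y in K. \<forall>i. b y = i \<longrightarrow> emeasure K (b -` {i} \<inter> space K) \<noteq> 0"
    by (subst AE_all_countable) simp
  then show ?thesis by simp
qed

lemma nn_integral_normalized_fibre:
  fixes b :: "'b \<Rightarrow> 'i::countable"
  assumes "prob_space K" and [measurable]: "b \<in> K \<rightarrow>\<^sub>M count_space UNIV"
    and "emeasure K (b -` {i} \<inter> space K) \<noteq> 0"
  shows "(\<integral>\<^sup>+y. (if b y = i then inverse (emeasure K (b -` {i} \<inter> space K)) else 0) \<partial>K) = 1"
proof -
  interpret prob_space K by fact
  have "(\<integral>\<^sup>+y. (if b y = i then inverse (emeasure K (b -` {i} \<inter> space K)) else 0) \<partial>K) =
      (\<integral>\<^sup>+y. inverse (emeasure K (b -` {i} \<inter> space K)) * indicator (b -` {i} \<inter> space K) y \<partial>K)"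
    by (intro nn_integral_cong) (auto simp: indicator_def)
  also have "\<dots> = inverse (emeasure K (b -` {i} \<inter> space K)) * emeasure K (b -` {i} \<inter> space K)"
    by (intro nn_integral_cmult_indicator) auto
  also have "\<dots> = 1"
    using assms(3) emeasure_finite
    by (subst mult.commute) (simp add: less_top[symmetric] flip: divide_ennreal_def)
  finally show ?thesis .
qed

text \<open>\<open>R\<close> makes the two coordinates conditionally independent given their common
  label. As the labels are countable, the conditional laws are normalized restrictions, and no
  disintegration is involved.\<close>

lemma glue_countable:
  fixes a :: "'a \<Rightarrow> 'i::countable" and b :: "'b \<Rightarrow> 'i"
  assumes P: "prob_space P" and K: "prob_space K"
    and am [measurable]: "a \<in> P \<rightarrow>\<^sub>M count_space UNIV" and bm [measurable]: "b \<in> K \<rightarrow>\<^sub>M count_space UNIV"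
    and eq: "distr P (count_space UNIV) a = distr K (count_space UNIV) b"
  obtains R where "prob_space R" "sets R = sets (P \<Otimes>\<^sub>M K)" "distr R P fst = P" "distr R K snd = K"
    "AE z in R. a (fst z) = b (snd z)"
proof -
  interpret P: prob_space P by fact
  interpret K: prob_space K by fact
  interpret PK: pair_prob_space P K ..
  define p where "p i = emeasure K (b -` {i} \<inter> space K)" for i
  \<comment> \<open>Equality of the label laws lets the single weight \<open>inverse (p i)\<close>
    normalize the fibres on both sides.\<close>
  have p: "p i = emeasure P (a -` {i} \<inter> space P)" for i
    using arg_cong[OF eq, of "\<lambda>M. emeasure M {i}"] by (simp add: emeasure_distr p_def)
  \<comment> \<open>\<open>inverse 0 = \<infinity>\<close> in \<open>ennreal\<close>, but fibres of mass zero are negligible\<close>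
  define w where "w z = (if a (fst z) = b (snd z) then inverse (p (b (snd z))) else 0)" for z
  have [measurable]: "w \<in> borel_measurable (P \<Otimes>\<^sub>M K)"
    unfolding w_def by measurable
  define R where "R = density (P \<Otimes>\<^sub>M K) w"
  have [measurable_cong]: "sets R = sets (P \<Otimes>\<^sub>M K)" by (simp add: R_def)
  \<comment> \<open>This and \<open>wP\<close> say that the density integrates to one along almost
    every section in either direction; both marginals of \<open>R\<close> then follow by
    Tonelli.\<close>
  have wK: "AE x in P. (\<integral>\<^sup>+y. w (x, y) \<partial>K) = 1"
    using AE_fibre_nonnull[OF am]
  proof eventually_elim
    case (elim x)
    have "(\<integral>\<^sup>+y. w (x, y) \<partial>K) = (\<integral>\<^sup>+y. (if b y = a x then inverse (p (a x)) else 0) \<partial>K)"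
      by (intro nn_integral_cong) (auto simp: w_def)
    then show ?case
      using nn_integral_normalized_fibre[OF K bm, of "a x", folded p_def] elim[folded p] by simp
  qed
  have wP: "AE y in K. (\<integral>\<^sup>+x. w (x, y) \<partial>P) = 1"
    using AE_fibre_nonnull[OF bm]
  proof eventually_elim
    case (elim y)
    have "(\<integral>\<^sup>+x. w (x, y) \<partial>P) = (\<integral>\<^sup>+x. (if a x = b y then inverse (p (b y)) else 0) \<partial>P)"
      by (intro nn_integral_cong) (auto simp: w_def)
    then show ?case
      using nn_integral_normalized_fibre[OF P am, of "b y", folded p] elim[folded p_def] by simp
  qed
  have 1: "distr R P fst = P"
  proof (rule measure_eqI)
    fix A assume "A \<in> sets (distr R P fst)"
    then have [measurable]: "A \<in> sets P" by simp
    have "emeasure (distr R P fst) A = (\<integral>\<^sup>+z. indicator A (fst z) \<partial>R)"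
      by (subst nn_integral_distr[where f="indicator A" and T=fst and M'=P, symmetric]) auto
    also have "\<dots> = (\<integral>\<^sup>+z. w z * indicator A (fst z) \<partial>(P \<Otimes>\<^sub>M K))"
      unfolding R_def by (rule nn_integral_density) measurable
    also have "\<dots> = (\<integral>\<^sup>+x. \<integral>\<^sup>+y. w (x, y) * indicator A x \<partial>K \<partial>P)"
      by (subst K.nn_integral_fst[symmetric]) auto
    also have "\<dots> = (\<integral>\<^sup>+x. (\<integral>\<^sup>+y. w (x, y) \<partial>K) * indicator A x \<partial>P)"
      by (intro nn_integral_cong nn_integral_multc) measurable
    also have "\<dots> = (\<integral>\<^sup>+x. indicator A x \<partial>P)"
      using wK by (intro nn_integral_cong_AE) auto
    finally show "emeasure (distr R P fst) A = emeasure P A" by simp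
  qed simp
  have 2: "distr R K snd = K"
  proof (rule measure_eqI)
    fix A assume "A \<in> sets (distr R K snd)"
    then have [measurable]: "A \<in> sets K" by simp
    have "emeasure (distr R K snd) A = (\<integral>\<^sup>+z. indicator A (snd z) \<partial>R)"
      by (subst nn_integral_distr[where f="indicator A" and T=snd and M'=K, symmetric]) auto
    also have "\<dots> = (\<integral>\<^sup>+z. w z * indicator A (snd z) \<partial>(P \<Otimes>\<^sub>M K))"
      unfolding R_def by (rule nn_integral_density) measurable
    also have "\<dots> = (\<integral>\<^sup>+y. \<integral>\<^sup>+x. w (x, y) * indicator A y \<partial>P \<partial>K)"
      by (subst PK.nn_integral_snd[symmetric]) auto
    also have "\<dots> = (\<integral>\<^sup>+y. (\<integral>\<^sup>+x. w (x, y) \<partial>P) * indicator A y \<partial>K)"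
      by (intro nn_integral_cong nn_integral_multc) measurable
    also have "\<dots> = (\<integral>\<^sup>+y. indicator A y \<partial>K)"
      using wP by (intro nn_integral_cong_AE) auto
    finally show "emeasure (distr R K snd) A = emeasure K A" by simp
  qed simp
  have 3: "AE z in R. a (fst z) = b (snd z)"
    unfolding R_def by (subst AE_density) (auto simp: w_def)
  have "prob_space R"
    by (rule prob_space_distrD[where f=fst and N=P]) (simp_all add: 1 P)
  with 1 2 3 show thesis by (intro that[of R]) (simp_all add: R_def)
qed

text \<open>Each point is labelled by the first member of a countable dense sequence at distance
  below \<open>e / 2\<close>; two points with the same label are then at distance below
  \<open>e\<close>.\<close>

lemma fine_countable_partition:
  fixes e :: real
  assumes "e > 0"
  obtains f :: "'a::euclidean_space \<Rightarrow> nat"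
  where "f \<in> borel \<rightarrow>\<^sub>M count_space UNIV" "\<And>x y. f x = f y \<Longrightarrow> dist x y < e"
proof -
  obtain D :: "'a set" where D: "countable D" "\<And>X. open X \<Longrightarrow> X \<noteq> {} \<Longrightarrow> \<exists>d\<in>D. d \<in> X"
    using countable_dense_setE by blast
  from D(2)[of UNIV] have "D \<noteq> {}" by auto
  define d where "d = from_nat_into D"
  have d: "\<exists>n. dist x (d n) < e / 2" for x
  proof -
    obtain z where "z \<in> D" "z \<in> ball x (e / 2)"
      using D(2)[of "ball x (e / 2)"] assms by auto
    with from_nat_into_surj[OF D(1)] show ?thesis unfolding d_def mem_ball by metis
  qed
  define f where "f x = (LEAST n. dist x (d n) < e / 2)" for x
  have f: "dist x (d (f x)) < e / 2" for x
    using LeastI_ex[OF d] by (simp add: f_def)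
  show thesis
  proof
    show "f \<in> borel \<rightarrow>\<^sub>M count_space UNIV" unfolding f_def by measurable
    show "dist x y < e" if "f x = f y" for x y
      using dist_triangle_half_l[OF f[of x], of y] f[of y] that by (simp add: dist_commute)
  qed
qed

section \<open>Upper bound for the transport cost through the barycenter\<close>

lemma W2_sq_le_kernel_variance_plus_cost:
  assumes k: "markov_kernel k" and \<mu>: "prob_space \<mu>" "sets \<mu> = sets borel"
    and int: "AE x in \<mu>. integrable (k x) (\<lambda>y. y)"
    and \<pi>: "\<pi> \<in> couplings \<mu> (distr \<mu> borel (barycenter_map k))"
  shows "W2_sq \<mu> (\<mu> \<bind> k) \<le> transport_cost \<pi> + (\<integral>\<^sup>+x. kernel_variance k x \<partial>\<mu>)"
proof -
  note [measurable_cong] = \<mu>(2)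
  note [measurable] = barycenter_map_measurable[OF k] kernel_variance_measurable[OF k]
  let ?V = "\<integral>\<^sup>+x. kernel_variance k x \<partial>\<mu>" and ?T = "barycenter_map k"
  from \<pi> have \<pi>': "prob_space \<pi>" and [measurable_cong]: "sets \<pi> = sets (borel \<Otimes>\<^sub>M borel)"
    and fst: "distr \<pi> borel fst = \<mu>" and snd: "distr \<pi> borel snd = distr \<mu> borel ?T"
    by (auto simp: couplings_def)
  have bound: "W2_sq \<mu> (\<mu> \<bind> k) \<le> ?V + (ennreal (1 + e) * transport_cost \<pi> + ennreal (e\<^sup>2 + e))"
    if e: "e > 0" for e :: real
  proof -
    obtain f :: "'a \<Rightarrow> nat" where [measurable]: "f \<in> borel \<rightarrow>\<^sub>M count_space UNIV"
      and f: "\<And>x y. f x = f y \<Longrightarrow> dist x y < e"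
      using fine_countable_partition[OF e] by blast
    have "distr \<pi> (count_space UNIV) (\<lambda>p. f (snd p)) = distr (distr \<pi> borel snd) (count_space UNIV) f"
      by (subst distr_distr) (auto simp: comp_def)
    also have "\<dots> = distr \<mu> (count_space UNIV) (\<lambda>x. f (?T x))"
      unfolding snd by (subst distr_distr) (auto simp: comp_def)
    finally obtain R where R: "prob_space R" and [measurable_cong]: "sets R = sets (\<pi> \<Otimes>\<^sub>M \<mu>)"
      and R1: "distr R \<pi> fst = \<pi>" and R2: "distr R \<mu> snd = \<mu>"
      and AE: "AE z in R. f (snd (fst z)) = f (?T (snd z))"
      using glue_countable[OF \<pi>' \<mu>(1), of "\<lambda>p. f (snd p)" "\<lambda>x. f (?T x)"] by auto
    interpret R: prob_space R by (rule R)
    \<comment> \<open>A point of \<open>R\<close> is \<open>((x', z), x)\<close> with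
      \<open>z\<close> close to \<open>?T x\<close>. Dropping \<open>z\<close> leaves a pair
      \<open>(x', x)\<close> whose marginals are both \<mu>, so appending \<open>k\<close> couples
      \<mu> with \<open>\<mu> \<bind> k\<close>.\<close>
    define S where "S = distr R (borel \<Otimes>\<^sub>M borel) (\<lambda>z. (fst (fst z), snd z))"
    have S: "prob_space S" "sets S = sets (borel \<Otimes>\<^sub>M borel)"
      unfolding S_def by (auto intro!: R.prob_space_distr)
    have "distr S borel fst = distr (distr R \<pi> fst) borel fst"
      unfolding S_def by (subst (1 2) distr_distr) (auto simp: comp_def)
    then have S1: "distr S borel fst = \<mu>" by (simp add: R1 fst)
    have "distr S borel snd = distr (distr R \<mu> snd) \<mu> (\<lambda>x. x)"
      unfolding S_def by (subst (1 2) distr_distr) (auto simp: comp_def \<mu>(2) intro!: distr_cong)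
    then have S2: "distr S borel snd = \<mu>" by (simp add: R2)
    have "W2_sq \<mu> (\<mu> \<bind> k) \<le> transport_cost (append_kernel S k)"
      unfolding W2_sq_def using append_kernel_couplings[OF k S] by (intro INF_lower) (simp add: S1 S2)
    also have "\<dots> = ?V + transport_cost (distr S (borel \<Otimes>\<^sub>M borel) (\<lambda>(x, w). (x, ?T w)))"
      using transport_cost_append_kernel[OF k S, unfolded S2] int by simp
    also have "transport_cost (distr S (borel \<Otimes>\<^sub>M borel) (\<lambda>(x, w). (x, ?T w))) =
        (\<integral>\<^sup>+z. ennreal ((norm (?T (snd z) - fst (fst z)))\<^sup>2) \<partial>R)"
      unfolding transport_cost_def S_def by (simp add: nn_integral_distr case_prod_beta)
    also have "\<dots> \<le> (\<integral>\<^sup>+z. ennreal (1 + e) * ennreal ((norm (snd (fst z) - fst (fst z)))\<^sup>2) + ennreal (e\<^sup>2 + e) \<partial>R)"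
    proof (rule nn_integral_mono_AE, use AE in eventually_elim)
      case (elim z)
      let ?a = "norm (snd (fst z) - fst (fst z))"
      have "norm (?T (snd z) - fst (fst z)) \<le> norm (?T (snd z) - snd (fst z)) + ?a"
        using norm_triangle_ineq[of "?T (snd z) - snd (fst z)" "snd (fst z) - fst (fst z)"] by simp
      also have "norm (?T (snd z) - snd (fst z)) \<le> e"
        using f[OF elim] by (simp add: dist_norm norm_minus_commute)
      finally have "(norm (?T (snd z) - fst (fst z)))\<^sup>2 \<le> (e + ?a)\<^sup>2"
        by (intro power_mono) auto
      \<comment> \<open>The cross term is absorbed by \<open>2 * ?a \<le> 1 + ?a\<^sup>2\<close>, so
        every error term carries a factor \<open>e\<close>.\<close>
      also have "\<dots> \<le> (1 + e) * ?a\<^sup>2 + (e\<^sup>2 + e)"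
      proof -
        have "e * (2 * ?a) \<le> e * (1 + ?a\<^sup>2)"
          using e sum_squares_bound[of 1 ?a] by (intro mult_left_mono) auto
        then show ?thesis by (simp add: power2_sum algebra_simps)
      qed
      finally show ?case
        using e by (simp add: ennreal_plus[symmetric] ennreal_mult'[symmetric] del: ennreal_plus)
    qed
    also have "\<dots> = ennreal (1 + e) * (\<integral>\<^sup>+z. ennreal ((norm (snd (fst z) - fst (fst z)))\<^sup>2) \<partial>R) + ennreal (e\<^sup>2 + e)"
      by (simp add: nn_integral_add nn_integral_cmult R.emeasure_space_1)
    also have "(\<integral>\<^sup>+z. ennreal ((norm (snd (fst z) - fst (fst z)))\<^sup>2) \<partial>R) = transport_cost (distr R \<pi> fst)"
      by (simp add: transport_cost_def nn_integral_distr case_prod_beta)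
    finally show ?thesis
      by (simp add: R1 add_left_mono)
  qed
  show ?thesis
  proof (cases "transport_cost \<pi>")
    case (real c)
    show ?thesis
    proof (rule ennreal_le_epsilon)
      fix d :: real assume "0 < d"
      \<comment> \<open>As \<open>e \<le> 1\<close>, the error \<open>e * c + e\<^sup>2 + e\<close>
        is at most \<open>e * (c + 2)\<close>, hence at most \<open>d\<close>.\<close>
      define e where "e = min 1 (d / (c + 2))"
      have e: "0 < e" "e \<le> 1" "e \<le> d / (c + 2)" using \<open>0 < d\<close> real by (auto simp: e_def)
      have "e\<^sup>2 \<le> e" using e by (simp add: power2_eq_square mult_left_le)
      moreover have "e * (c + 2) \<le> d" using e(3) real by (simp add: field_simps)
      ultimately have "(1 + e) * c + (e\<^sup>2 + e) \<le> c + d" by (simp add: algebra_simps)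
      then have "ennreal (1 + e) * transport_cost \<pi> + ennreal (e\<^sup>2 + e) \<le> transport_cost \<pi> + ennreal d"
        using e \<open>0 < d\<close> real
        by (simp add: ennreal_plus[symmetric] ennreal_mult'[symmetric] ennreal_leI del: ennreal_plus)
      from order_trans[OF bound[OF e(1)] add_left_mono[OF this]]
      show "W2_sq \<mu> (\<mu> \<bind> k) \<le> transport_cost \<pi> + ?V + ennreal d"
        by (simp only: ac_simps)
    qed
  qed simp
qed

text \<open>The infimum over all couplings of \<mu> with the law of the barycenter is taken in the
  previous bound. The variance is first moved to the other side, which is legitimate in
  \<open>ennreal\<close> when it is finite; otherwise the bound is trivial.\<close>

lemma W2_sq_le_barycenter:
  assumes k: "markov_kernel k" and \<mu>: "prob_space \<mu>" "sets \<mu> = sets borel"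
    and int: "AE x in \<mu>. integrable (k x) (\<lambda>y. y)"
  shows "W2_sq \<mu> (\<mu> \<bind> k) \<le>
     W2_sq \<mu> (distr \<mu> borel (barycenter_map k)) + (\<integral>\<^sup>+x. kernel_variance k x \<partial>\<mu>)"
proof (cases "(\<integral>\<^sup>+x. kernel_variance k x \<partial>\<mu>) = \<top>")
  case False
  let ?V = "\<integral>\<^sup>+x. kernel_variance k x \<partial>\<mu>"
  have "W2_sq \<mu> (\<mu> \<bind> k) - ?V \<le> W2_sq \<mu> (distr \<mu> borel (barycenter_map k))"
    unfolding W2_sq_def[of \<mu> "distr \<mu> borel (barycenter_map k)"]
    using W2_sq_le_kernel_variance_plus_cost[OF assms] False
    by (intro INF_greatest) (simp add: ennreal_minus_le_iff add.commute)
  then show ?thesis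
    using False by (simp add: ennreal_minus_le_iff add.commute)
qed simp

subsection \<open>Convex order\<close>

text \<open>A hyperplane separates the strict epigraph from the point \<open>(z, \<phi> z)\<close>
  on the graph. It is not vertical, so rescaling its normal yields the slope
  \<open>g\<close>.\<close>

lemma convex_on_subgradient:
  fixes \<phi> :: "'a::euclidean_space \<Rightarrow> real"
  assumes "convex_on UNIV \<phi>"
  obtains g where "\<And>y. \<phi> z + inner g (y - z) \<le> \<phi> y"
proof -
  define E where "E = {p :: 'a \<times> real. \<phi> (fst p) < snd p}"
  have "convex E"
  proof (rule convexI)
    fix p q :: "'a \<times> real" and u v :: real
    assume *: "p \<in> E" "q \<in> E" "0 \<le> u" "0 \<le> v" "u + v = 1"
    have "\<phi> (u *\<^sub>R fst p + v *\<^sub>R fst q) \<le> u * \<phi> (fst p) + v * \<phi> (fst q)"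
      using assms * by (auto simp: convex_on_def)
    also have "\<dots> < u * snd p + v * snd q"
    proof (cases "u = 0")
      case False
      with * show ?thesis by (intro add_less_le_mono mult_strict_left_mono mult_left_mono) (auto simp: E_def)
    qed (use * in \<open>auto simp: E_def\<close>)
    finally show "u *\<^sub>R p + v *\<^sub>R q \<in> E" by (simp add: E_def)
  qed
  moreover have "(z, \<phi> z + 1) \<in> E" "E \<inter> {(z, \<phi> z)} = {}" by (auto simp: E_def)
  ultimately obtain a b where "a \<noteq> 0" and a: "\<And>p. p \<in> E \<Longrightarrow> inner a p \<le> b" "inner a (z, \<phi> z) \<ge> b"
    using separating_hyperplane_sets[of E "{(z, \<phi> z)}"] by fastforce
  obtain p s where ps: "a = (p, s)" by (cases a)
  have above: "inner p x + s * t \<le> inner p z + s * \<phi> z" if "\<phi> x < t" for x t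
    using a(1)[of "(x, t)"] a(2) that by (auto simp: ps E_def inner_Pair)
  have "s \<le> 0"
    using above[of z "\<phi> z + 1"] by (simp add: algebra_simps)
  \<comment> \<open>A vertical hyperplane would have to bound \<open>inner p x\<close> above by
    \<open>inner p z\<close> for all \<open>x\<close>; testing \<open>x = z + p\<close> gives
    \<open>p = 0\<close> and contradicts \<open>a \<noteq> 0\<close>.\<close>
  moreover have "s \<noteq> 0"
  proof
    assume "s = 0"
    with above[of "z + p" "\<phi> (z + p) + 1"] have "inner p p \<le> 0" by (simp add: inner_add)
    then have "p = 0" by (metis inner_gt_zero_iff not_less)
    with \<open>s = 0\<close> \<open>a \<noteq> 0\<close> show False by (simp add: ps zero_prod_def)
  qed
  ultimately have s: "s < 0" by simp
  show thesis
  proof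
    fix y
    show "\<phi> z + inner ((1 / - s) *\<^sub>R p) (y - z) \<le> \<phi> y"
    proof (rule field_le_epsilon)
      fix e :: real assume "0 < e"
      then have "inner p y + s * (\<phi> y + e) \<le> inner p z + s * \<phi> z" by (intro above) simp
      then show "\<phi> z + inner ((1 / - s) *\<^sub>R p) (y - z) \<le> \<phi> y + e"
        using s by (simp add: field_simps inner_diff)
    qed
  qed
qed

lemma convex_on_borel_measurable:
  fixes \<phi> :: "'a::euclidean_space \<Rightarrow> real"
  assumes "convex_on UNIV \<phi>"
  shows "\<phi> \<in> borel_measurable borel"
  by (rule borel_measurable_continuous_onI[OF convex_on_continuous[OF open_UNIV assms]])

text \<open>Integrating the supporting affine function at the mean, whose linear part averages to
  zero, gives the bound. If \<psi> is not integrable, the right-hand side is infinite because \<psi>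
  is nonnegative.\<close>

lemma nn_integral_jensen:
  fixes \<psi> :: "'a::euclidean_space \<Rightarrow> real"
  assumes "prob_space M" and [measurable_cong]: "sets M = sets borel"
    and int: "integrable M (\<lambda>y. y)" and cvx: "convex_on UNIV \<psi>" and nn: "\<And>y. 0 \<le> \<psi> y"
  shows "ennreal (\<psi> (\<integral>y. y \<partial>M)) \<le> (\<integral>\<^sup>+y. ennreal (\<psi> y) \<partial>M)"
proof (cases "integrable M \<psi>")
  case True
  interpret prob_space M by fact
  define b where "b = (\<integral>y. y \<partial>M)"
  obtain g where g: "\<And>y. \<psi> b + inner g (y - b) \<le> \<psi> y"
    using convex_on_subgradient[OF cvx] by blast
  have "(\<integral>y. inner g (y - b) \<partial>M) = inner g (\<integral>y. y - b \<partial>M)"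
    using int by (intro integral_inner_right) auto
  also have "(\<integral>y. y - b \<partial>M) = 0"
    using int by (simp add: b_def prob_space)
  finally have zero: "(\<integral>y. inner g (y - b) \<partial>M) = 0" by simp
  have i: "integrable M (\<lambda>y. inner g (y - b))"
    using int by (intro integrable_inner_right Bochner_Integration.integrable_diff) auto
  have "(\<integral>y. \<psi> b + inner g (y - b) \<partial>M) \<le> (\<integral>y. \<psi> y \<partial>M)"
    using True i g by (intro integral_mono) auto
  then have "\<psi> b \<le> (\<integral>y. \<psi> y \<partial>M)"
    using i zero by (simp add: prob_space)
  with True nn show ?thesis
    by (simp add: nn_integral_eq_integral b_def ennreal_leI)
next
  case False
  have [measurable]: "\<psi> \<in> borel_measurable borel" by (rule convex_on_borel_measurable[OF cvx])
  have "(\<integral>\<^sup>+y. ennreal (\<psi> y) \<partial>M) = \<infinity>"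
    using False nn by (subst (asm) integrable_iff_bounded) (simp add: less_top[symmetric])
  then show ?thesis by simp
qed

text \<open>Splits the extended integral of a function with an integrable affine minorant. The
  negative part is dominated by that of \<open>l\<close> and hence has finite integral, so no
  \<open>\<infinity> - \<infinity>\<close> arises.\<close>

lemma ext_integral_nonneg_plus_integrable:
  assumes [measurable]: "\<psi> \<in> borel_measurable M" and nn: "\<And>x. 0 \<le> \<psi> x" and l: "integrable M l"
  shows "ext_integral M (\<lambda>x. \<psi> x + l x) = enn2ereal (\<integral>\<^sup>+x. ennreal (\<psi> x) \<partial>M) + ereal (\<integral>x. l x \<partial>M)"
proof -
  have [measurable]: "l \<in> borel_measurable M" using l by simp
  let ?P = "\<integral>\<^sup>+x. ennreal (\<psi> x + l x) \<partial>M" and ?N = "\<integral>\<^sup>+x. ennreal (- (\<psi> x + l x)) \<partial>M"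
  have lfin: "(\<integral>\<^sup>+x. ennreal (- l x) \<partial>M) < \<infinity>"
    using l by (simp add: real_integrable_def less_top)
  have "?N \<le> (\<integral>\<^sup>+x. ennreal (- l x) \<partial>M)"
    using nn by (intro nn_integral_mono ennreal_leI) simp
  with lfin have N: "?N < \<infinity>" by order
  show ?thesis
  proof (cases "integrable M \<psi>")
    case True
    then have i: "integrable M (\<lambda>x. \<psi> x + l x)" using l by simp
    then have "?P < \<infinity>" by (simp add: real_integrable_def less_top)
    with N have "ext_integral M (\<lambda>x. \<psi> x + l x) = ereal (enn2real ?P - enn2real ?N)"
      unfolding ext_integral_def
      by (cases ?P; cases ?N) (auto simp: enn2ereal_ennreal simp del: ennreal_neg)
    also have "enn2real ?P - enn2real ?N = (\<integral>x. \<psi> x + l x \<partial>M)"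
      by (rule real_lebesgue_integral_def[OF i, symmetric])
    finally show ?thesis
      using True l nn by (simp add: nn_integral_eq_integral enn2ereal_ennreal)
  next
    case False
    have inf: "(\<integral>\<^sup>+x. ennreal (\<psi> x) \<partial>M) = \<infinity>"
      using False nn by (subst (asm) integrable_iff_bounded) (simp add: less_top[symmetric])
    \<comment> \<open>As the negative part of \<open>l\<close> has finite integral, this forces the
      positive part of \<open>\<psi> + l\<close> to have infinite integral.\<close>
    have "(\<integral>\<^sup>+x. ennreal (\<psi> x) \<partial>M) \<le> (\<integral>\<^sup>+x. ennreal (\<psi> x + l x) + ennreal (- l x) \<partial>M)"
    proof (rule nn_integral_mono)
      fix x
      have "ennreal (\<psi> x) = ennreal ((\<psi> x + l x) + - l x)" by simp
      also have "\<dots> \<le> ennreal (\<psi> x + l x) + ennreal (- l x)"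
        by (cases "0 \<le> \<psi> x + l x"; cases "0 \<le> - l x")
           (auto simp: ennreal_neg ennreal_plus[symmetric] simp del: ennreal_plus intro!: ennreal_leI)
      finally show "ennreal (\<psi> x) \<le> ennreal (\<psi> x + l x) + ennreal (- l x)" .
    qed
    also have "\<dots> = ?P + (\<integral>\<^sup>+x. ennreal (- l x) \<partial>M)"
      by (rule nn_integral_add) measurable
    finally have "?P = \<infinity>" using inf lfin by (auto simp: top_unique ennreal_add_eq_top)
    with N inf show ?thesis
      unfolding ext_integral_def by (cases ?N) (auto simp: enn2ereal_ennreal)
  qed
qed

lemma convex_order_barycenter:
  assumes k: "markov_kernel k" and \<mu>: "prob_space \<mu>" "sets \<mu> = sets borel" and \<nu>: "\<mu> \<bind> k \<in> P2"
  shows "distr \<mu> borel (barycenter_map k) \<le>\<^sub>c\<^sub>x \<mu> \<bind> k"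
proof -
  let ?T = "barycenter_map k" and ?\<nu> = "\<mu> \<bind> k"
  let ?\<eta> = "distr \<mu> borel ?T" and ?V = "\<integral>\<^sup>+x. kernel_variance k x \<partial>\<mu>"
  note [measurable_cong] = \<mu>(2)
  note [measurable] = barycenter_map_measurable[OF k]
  have K: "k \<in> \<mu> \<rightarrow>\<^sub>M subprob_algebra borel"
    using markov_kernel_measurable[OF k] by (simp cong: measurable_cong_sets)
  note int = AE_kernel_integrable[OF k \<mu>(2) \<nu>]
  note var = nn_integral_norm_diff_sq_bind[OF k \<mu>(2) int]
  have fin: "(\<integral>\<^sup>+y. ennreal ((norm y)\<^sup>2) \<partial>?\<nu>) < \<infinity>" using \<nu> by (simp add: P2_def)
  have \<eta>: "?\<eta> \<in> P2"
    using fin \<mu> var[of 0] by (auto simp: P2_def intro!: prob_space.prob_space_distr)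
  have V: "?V < \<infinity>" using fin var[of 0] by auto
  have i\<nu>: "integrable ?\<nu> (\<lambda>y. y)" and i\<eta>: "integrable ?\<eta> (\<lambda>y. y)"
    using P2_integrable \<nu> \<eta> by blast+
  have s\<nu>: "sets ?\<nu> = sets borel" "prob_space ?\<nu>" using \<nu> by (auto simp: P2_def)
  note [measurable_cong] = s\<nu>(1)
  \<comment> \<open>Only nonnegative integrals are exchanged: the second moment of
    \<open>?\<nu>\<close> around \<open>?m\<close> and around \<open>?n\<close> is computed in two
    ways, by the kernel decomposition and by the bias-variance identity.\<close>
  have mean: "(\<integral>y. y \<partial>?\<nu>) = (\<integral>y. y \<partial>?\<eta>)" (is "?m = ?n")
  proof -
    let ?A = "\<integral>\<^sup>+y. ennreal ((norm (y - ?m))\<^sup>2) \<partial>?\<nu>" and ?B = "\<integral>\<^sup>+y. ennreal ((norm (y - ?n))\<^sup>2) \<partial>?\<eta>"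
    let ?X = "ennreal ((norm (?m - ?n))\<^sup>2)"
    note 1 = nn_integral_norm_diff_sq[OF s\<nu>(2,1) i\<nu>]
    note 2 = nn_integral_norm_diff_sq[OF _ _ i\<eta>]
    have \<eta>': "prob_space ?\<eta>" "sets ?\<eta> = sets borel" using \<eta> by (auto simp: P2_def)
    have "?A = ?V + (?B + ?X)"
      using var[of ?m] 2[OF \<eta>', of ?m] by (simp add: norm_minus_commute)
    moreover have "?A + ?X = ?V + ?B"
      using var[of ?n] 1[of ?n] by simp
    moreover have "?A < \<infinity>" using fin 1[of 0] by simp
    \<comment> \<open>adding the two identities gives \<open>2 * ?X = 0\<close> because all terms are finite\<close>
    ultimately have "?X = 0"
      by (cases ?A; cases ?V; cases ?B) (auto simp flip: ennreal_plus)
    then show ?thesis by simp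
  qed
  show ?thesis
    unfolding convex_order_def
  proof (intro allI impI)
    fix \<phi> :: "'a \<Rightarrow> real" assume cvx: "convex_on UNIV \<phi>"
    obtain g where g: "\<And>y. \<phi> 0 + inner g (y - 0) \<le> \<phi> y"
      using convex_on_subgradient[OF cvx] by blast
    define l where "l y = \<phi> 0 + inner g y" for y
    define \<psi> where "\<psi> y = \<phi> y - l y" for y
    have \<psi>: "0 \<le> \<psi> y" for y using g[of y] by (simp add: \<psi>_def l_def)
    have "convex_on UNIV (\<lambda>y. - l y)"
      by (rule convex_onI) (simp_all add: l_def inner_add_right algebra_simps)
    from convex_on_add[OF cvx this] have cvx': "convex_on UNIV \<psi>"
      by (simp add: \<psi>_def[abs_def])
    note [measurable] = convex_on_borel_measurable[OF cvx']
    \<comment> \<open>The affine part sees \<open>M\<close> only through its mean, so between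
      \<open>?\<eta>\<close> and \<open>?\<nu>\<close> only the integrals of the nonnegative convex
      function \<psi> remain to be compared.\<close>
    have ext: "ext_integral M \<phi> = enn2ereal (\<integral>\<^sup>+x. ennreal (\<psi> x) \<partial>M) + ereal (\<phi> 0 + inner g (\<integral>y. y \<partial>M))"
      if M: "M \<in> P2" for M
    proof -
      interpret prob_space M using M by (simp add: P2_def)
      have [measurable_cong]: "sets M = sets borel" using M by (simp add: P2_def)
      have i: "integrable M (\<lambda>y. y)" by (rule P2_integrable[OF M])
      then have l: "integrable M l" unfolding l_def by auto
      have "(\<integral>y. l y \<partial>M) = \<phi> 0 + inner g (\<integral>y. y \<partial>M)"
        using i by (simp add: l_def prob_space)
      moreover have "\<psi> \<in> borel_measurable M" by measurable
      moreover have "(\<lambda>x. \<psi> x + l x) = \<phi>" by (simp add: \<psi>_def)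
      ultimately show ?thesis
        using ext_integral_nonneg_plus_integrable[of \<psi> M l] \<psi> l by simp
    qed
    have "(\<integral>\<^sup>+x. ennreal (\<psi> x) \<partial>?\<eta>) = (\<integral>\<^sup>+x. ennreal (\<psi> (?T x)) \<partial>\<mu>)"
      by (simp add: nn_integral_distr)
    also have "\<dots> \<le> (\<integral>\<^sup>+x. \<integral>\<^sup>+y. ennreal (\<psi> y) \<partial>k x \<partial>\<mu>)"
    proof (rule nn_integral_mono_AE, use int in eventually_elim)
      case (elim x)
      show ?case
        unfolding barycenter_map_def
        by (rule nn_integral_jensen[OF markov_kernelD[OF k] elim cvx' \<psi>])
    qed
    also have "\<dots> = (\<integral>\<^sup>+y. ennreal (\<psi> y) \<partial>?\<nu>)"
      by (subst nn_integral_bind[OF _ K]) auto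
    finally show "ext_integral ?\<eta> \<phi> \<le> ext_integral ?\<nu> \<phi>"
      unfolding ext[OF \<eta>] ext[OF \<nu>] mean
      by (intro add_right_mono) (simp add: less_eq_ennreal.rep_eq)
  qed
qed

subsection \<open>The projection of an optimal kernel\<close>

lemma kernel_coupling_bind:
  assumes k: "markov_kernel k" and \<mu>: "prob_space \<mu>" "sets \<mu> = sets borel"
  shows "kernel_coupling \<mu> k \<in> couplings \<mu> (\<mu> \<bind> k)"
proof -
  note [measurable_cong] = \<mu>(2)
  let ?D = "distr \<mu> (borel \<Otimes>\<^sub>M borel) (\<lambda>x. (x, x))"
  have D: "prob_space ?D" "sets ?D = sets (borel \<Otimes>\<^sub>M borel)"
    using \<mu>(1) by (auto intro!: prob_space.prob_space_distr)
  have "distr ?D borel fst = \<mu>" "distr ?D borel snd = \<mu>"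
    using \<mu>(2) by (simp_all add: distr_distr comp_def distr_id2)
  then show ?thesis
    using append_kernel_couplings[OF k D] by (simp add: kernel_coupling_eq_append_kernel[OF k \<mu>])
qed

lemma couplings_kernel_couplingD:
  assumes "markov_kernel k" "prob_space \<mu>" "sets \<mu> = sets borel"
    and "kernel_coupling \<mu> k \<in> couplings \<mu> \<nu>"
  shows "\<nu> = \<mu> \<bind> k"
  using kernel_coupling_bind[OF assms(1-3)] assms(4) by (simp add: couplings_def)

lemma transport_cost_kernel_coupling:
  assumes k: "markov_kernel k" and \<mu>: "prob_space \<mu>" "sets \<mu> = sets borel"
    and int: "AE x in \<mu>. integrable (k x) (\<lambda>y. y)"
  shows "transport_cost (kernel_coupling \<mu> k) = (\<integral>\<^sup>+x. kernel_variance k x \<partial>\<mu>) +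
     transport_cost (distr \<mu> (borel \<Otimes>\<^sub>M borel) (\<lambda>x. (x, barycenter_map k x)))"
proof -
  note [measurable_cong] = \<mu>(2)
  note [measurable] = barycenter_map_measurable[OF k]
  let ?D = "distr \<mu> (borel \<Otimes>\<^sub>M borel) (\<lambda>x. (x, x))"
  have D: "prob_space ?D" "sets ?D = sets (borel \<Otimes>\<^sub>M borel)"
    using \<mu>(1) by (auto intro!: prob_space.prob_space_distr)
  have "distr ?D borel snd = \<mu>"
    using \<mu>(2) by (simp add: distr_distr comp_def distr_id2)
  from transport_cost_append_kernel[OF k D, unfolded this, OF int] show ?thesis
    by (simp add: kernel_coupling_eq_append_kernel[OF k \<mu>] distr_distr comp_def)
qed

lemma barycenter_coupling:
  assumes k: "markov_kernel k" and \<mu>: "prob_space \<mu>" "sets \<mu> = sets borel"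
  shows "distr \<mu> (borel \<Otimes>\<^sub>M borel) (\<lambda>x. (x, barycenter_map k x))
           \<in> couplings \<mu> (distr \<mu> borel (barycenter_map k))"
proof -
  note [measurable_cong] = \<mu>(2)
  note [measurable] = barycenter_map_measurable[OF k]
  show ?thesis
    using \<mu> by (auto simp: couplings_def distr_distr comp_def distr_id2 intro!: prob_space.prob_space_distr)
qed

text \<open>A finite second moment of \<nu> makes both \<open>v\<close> and the second moment of
  \<eta> finite, so the subtraction in \<open>ereal\<close> leaves exactly \<open>v\<close>, even if
  \<open>W2_sq \<mu> \<eta>\<close> is infinite.\<close>

lemma W2_splitI:
  assumes "W2_sq \<mu> \<nu> = v + W2_sq \<mu> \<eta>"
    and "(\<integral>\<^sup>+y. ennreal ((norm y)\<^sup>2) \<partial>\<nu>) = v + (\<integral>\<^sup>+z. ennreal ((norm z)\<^sup>2) \<partial>\<eta>)"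
    and "(\<integral>\<^sup>+y. ennreal ((norm y)\<^sup>2) \<partial>\<nu>) < \<infinity>"
  shows "W2_split \<mu> \<nu> \<eta>"
  using assms unfolding W2_split_def
  by (cases v; cases "W2_sq \<mu> \<eta>"; cases "\<integral>\<^sup>+z. ennreal ((norm z)\<^sup>2) \<partial>\<eta>")
     (auto simp: enn2ereal_ennreal ennreal_plus[symmetric] simp del: ennreal_plus)

lemma W2_splitD:
  assumes "W2_split \<mu> \<nu> \<eta>"
    and "(\<integral>\<^sup>+y. ennreal ((norm y)\<^sup>2) \<partial>\<nu>) = v + (\<integral>\<^sup>+z. ennreal ((norm z)\<^sup>2) \<partial>\<eta>)"
    and "(\<integral>\<^sup>+y. ennreal ((norm y)\<^sup>2) \<partial>\<nu>) < \<infinity>"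
  shows "W2_sq \<mu> \<nu> = v + W2_sq \<mu> \<eta>"
  using assms unfolding W2_split_def
  by (cases v; cases "W2_sq \<mu> \<eta>"; cases "W2_sq \<mu> \<nu>"; cases "\<integral>\<^sup>+z. ennreal ((norm z)\<^sup>2) \<partial>\<eta>")
     (auto simp: enn2ereal_ennreal ennreal_plus[symmetric] simp del: ennreal_plus)

lemma optimal_kernel_barycenter:
  assumes \<mu>: "\<mu> \<in> P2" and \<nu>: "\<nu> \<in> P2" and k: "markov_kernel k"
    and opt: "kernel_coupling \<mu> k \<in> opt_couplings \<mu> \<nu>"
  defines "\<eta> \<equiv> distr \<mu> borel (barycenter_map k)"
  shows "\<eta> \<le>\<^sub>c\<^sub>x \<nu>" and "W2_split \<mu> \<nu> \<eta>"
    and "distr \<mu> (borel \<Otimes>\<^sub>M borel) (\<lambda>x. (x, barycenter_map k x)) \<in> opt_couplings \<mu> \<eta>"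
proof -
  have \<mu>': "prob_space \<mu>" "sets \<mu> = sets borel" using \<mu> by (auto simp: P2_def)
  have eq: "\<nu> = \<mu> \<bind> k"
    using couplings_kernel_couplingD[OF k \<mu>'] opt by (simp add: opt_couplings_def)
  note int = AE_kernel_integrable[OF k \<mu>'(2) \<nu>[unfolded eq]]
  let ?V = "\<integral>\<^sup>+x. kernel_variance k x \<partial>\<mu>"
  let ?B = "distr \<mu> (borel \<Otimes>\<^sub>M borel) (\<lambda>x. (x, barycenter_map k x))"
  have moment: "(\<integral>\<^sup>+y. ennreal ((norm y)\<^sup>2) \<partial>\<nu>) = ?V + (\<integral>\<^sup>+z. ennreal ((norm z)\<^sup>2) \<partial>\<eta>)"
    using nn_integral_norm_diff_sq_bind[OF k \<mu>'(2) int, of 0] by (simp add: eq \<eta>_def)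
  have fin: "(\<integral>\<^sup>+y. ennreal ((norm y)\<^sup>2) \<partial>\<nu>) < \<infinity>" using \<nu> by (simp add: P2_def)
  have V: "?V < \<infinity>" using fin moment by auto
  have W: "W2_sq \<mu> \<nu> = ?V + transport_cost ?B"
    using opt transport_cost_kernel_coupling[OF k \<mu>' int] by (simp add: opt_couplings_def)
  have B: "?B \<in> couplings \<mu> \<eta>"
    unfolding \<eta>_def by (rule barycenter_coupling[OF k \<mu>'])
  \<comment> \<open>By optimality of \<open>k\<close> the left-hand side is
    \<open>W2_sq \<mu> \<nu>\<close>, which the gluing bound controls. Cancelling the finite
    \<open>?V\<close> shows that the barycenter map is optimal.\<close>
  have "?V + transport_cost ?B \<le> ?V + W2_sq \<mu> \<eta>"
    using W2_sq_le_barycenter[OF k \<mu>' int] W by (simp add: eq \<eta>_def add.commute)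
  then have "transport_cost ?B \<le> W2_sq \<mu> \<eta>"
    using V by (auto simp: ennreal_add_left_cancel_le)
  moreover have "W2_sq \<mu> \<eta> \<le> transport_cost ?B"
    unfolding W2_sq_def by (rule INF_lower[OF B])
  ultimately have cost: "transport_cost ?B = W2_sq \<mu> \<eta>" by simp
  show "\<eta> \<le>\<^sub>c\<^sub>x \<nu>"
    unfolding \<eta>_def eq by (rule convex_order_barycenter[OF k \<mu>' \<nu>[unfolded eq]])
  show "W2_split \<mu> \<nu> \<eta>"
    using W moment fin unfolding cost by (rule W2_splitI)
  show "?B \<in> opt_couplings \<mu> \<eta>"
    using B cost by (simp add: opt_couplings_def)
qed

section \<open>Composition with a martingale kernel\<close>

lemma martingale_kernel_barycenter:
  assumes "martingale_kernel m"
  shows "markov_kernel m" "barycenter_map m = (\<lambda>z. z)" "integrable (m z) (\<lambda>y. y)"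
  using assms by (auto simp: martingale_kernel_def barycenter_map_def)

text \<open>The barycenter map of \<open>m\<close> is the identity, so appending \<open>m\<close> to
  the optimal coupling of \<mu> and \<eta> adds exactly the variance of \<open>m\<close> to its
  cost. By the split identity the total is \<open>W2_sq \<mu> \<nu>\<close>.\<close>

lemma optimal_coupling_martingale_comp:
  assumes \<mu>: "\<mu> \<in> P2" and \<nu>: "\<nu> \<in> P2" and \<eta>: "prob_space \<eta>" "sets \<eta> = sets borel"
    and split: "W2_split \<mu> \<nu> \<eta>"
    and q: "markov_kernel q" and q_opt: "kernel_coupling \<mu> q \<in> opt_couplings \<mu> \<eta>"
    and m: "martingale_kernel m" and m_cpl: "kernel_coupling \<eta> m \<in> couplings \<eta> \<nu>"
  shows "kernel_coupling \<mu> (kernel_comp q m) \<in> opt_couplings \<mu> \<nu>"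
proof -
  have \<mu>': "prob_space \<mu>" "sets \<mu> = sets borel" using \<mu> by (auto simp: P2_def)
  note m' = martingale_kernel_barycenter[OF m]
  have eq: "\<nu> = \<eta> \<bind> m" by (rule couplings_kernel_couplingD[OF m'(1) \<eta> m_cpl])
  let ?Q = "kernel_coupling \<mu> q" and ?V = "\<integral>\<^sup>+z. kernel_variance m z \<partial>\<eta>"
  have Q: "prob_space ?Q" "sets ?Q = sets (borel \<Otimes>\<^sub>M borel)"
    and Q1: "distr ?Q borel fst = \<mu>" and Q2: "distr ?Q borel snd = \<eta>"
    and Qc: "transport_cost ?Q = W2_sq \<mu> \<eta>"
    using q_opt by (auto simp: opt_couplings_def couplings_def)
  have int: "AE z in \<eta>. integrable (m z) (\<lambda>y. y)" using m'(3) by simp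
  have "(\<integral>\<^sup>+y. ennreal ((norm y)\<^sup>2) \<partial>\<nu>) = ?V + (\<integral>\<^sup>+z. ennreal ((norm z)\<^sup>2) \<partial>\<eta>)"
    using nn_integral_norm_diff_sq_bind[OF m'(1) \<eta>(2) int, of 0] \<eta>(2)
    by (simp add: eq m'(2) distr_id2)
  from W2_splitD[OF split this] have W: "W2_sq \<mu> \<nu> = ?V + W2_sq \<mu> \<eta>"
    using \<nu> by (simp add: P2_def)
  have cpl: "append_kernel ?Q m \<in> couplings \<mu> \<nu>"
    using append_kernel_couplings[OF m'(1) Q] by (simp add: Q1 Q2 eq)
  have "transport_cost (append_kernel ?Q m) = ?V + W2_sq \<mu> \<eta>"
    using transport_cost_append_kernel[OF m'(1) Q, unfolded Q2, OF int] Q(2) Qc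
    by (simp add: m'(2) distr_id2 id_def)
  with cpl W show ?thesis
    by (simp add: opt_couplings_def kernel_coupling_kernel_comp[OF q m'(1) \<mu>'])
qed

theorem proposition1p7:
  fixes \<mu> \<nu> :: "(real ^ 'd) measure"
  assumes "\<mu> \<in> P2" and "\<nu> \<in> P2"
  shows
    "(\<forall>k \<T> \<eta>. markov_kernel k \<longrightarrow> kernel_coupling \<mu> k \<in> opt_couplings \<mu> \<nu> \<longrightarrow>
        \<T> = barycenter_map k \<longrightarrow> \<eta> = distr \<mu> borel \<T> \<longrightarrow>
        \<eta> \<le>\<^sub>c\<^sub>x \<nu> \<and> W2_split \<mu> \<nu> \<eta> \<and>
        distr \<mu> (borel \<Otimes>\<^sub>M borel) (\<lambda>x. (x, \<T> x)) \<in> opt_couplings \<mu> \<eta>) \<and>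
     (\<forall>\<eta>. prob_space \<eta> \<longrightarrow> sets \<eta> = sets borel \<longrightarrow> \<eta> \<le>\<^sub>c\<^sub>x \<nu> \<longrightarrow> W2_split \<mu> \<nu> \<eta> \<longrightarrow>
        (\<forall>q m. markov_kernel q \<longrightarrow> kernel_coupling \<mu> q \<in> opt_couplings \<mu> \<eta> \<longrightarrow>
           martingale_kernel m \<longrightarrow> kernel_coupling \<eta> m \<in> couplings \<eta> \<nu> \<longrightarrow>
           kernel_coupling \<mu> (kernel_comp q m) \<in> opt_couplings \<mu> \<nu>))"
proof (intro conjI allI impI)
  fix k \<T> \<eta>
  assume k: "markov_kernel k" "kernel_coupling \<mu> k \<in> opt_couplings \<mu> \<nu>"
    and T: "\<T> = barycenter_map k" and \<eta>: "\<eta> = distr \<mu> borel \<T>"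
  show "\<eta> \<le>\<^sub>c\<^sub>x \<nu>" "W2_split \<mu> \<nu> \<eta>"
    "distr \<mu> (borel \<Otimes>\<^sub>M borel) (\<lambda>x. (x, \<T> x)) \<in> opt_couplings \<mu> \<eta>"
    unfolding \<eta> T by (rule optimal_kernel_barycenter[OF assms k])+
next
  fix \<eta> :: "(real ^ 'd) measure" and q m
  assume "prob_space \<eta>" "sets \<eta> = sets borel" "W2_split \<mu> \<nu> \<eta>"
    "markov_kernel q" "kernel_coupling \<mu> q \<in> opt_couplings \<mu> \<eta>"
    "martingale_kernel m" "kernel_coupling \<eta> m \<in> couplings \<eta> \<nu>"
  then show "kernel_coupling \<mu> (kernel_comp q m) \<in> opt_couplings \<mu> \<nu>"
    by (rule optimal_coupling_martingale_comp[OF assms])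
qed

end
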